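(* Let $S,X,T$ be random variables on finite alphabets with $|\mathcal S|\geq 2$, with full-support marginals, such that $S-T-X$ is a Markov chain and the matrices $P_{T|X}$ and $P_{S|T}$ are invertible (so $|\mathcal S|=|\mathcal X|=|\mathcal T|$). Let $\epsilon>0$, $r>0$, and let $$P_2=\max\ \frac12\epsilon^2\sum_y P_y\|W^{T;Y}L_y\|^2,$$ where the maximum is over all finite alphabets $\mathcal Y$, probability distributions $(P_y)_{y\in\mathcal Y}$ and vectors $L_y\in\mathbb R^{|\mathcal S|}$ satisfying $L_y\perp\sqrt{P_S}$ for all $y$, $\sum_y P_yL_y=0$, $\|L_y\|^2\le 1$ for all $y$, and $\frac12\epsilon^2\sum_yP_y\|W^{X;Y}L_y\|^2\le r$. Let $\sigma_{\max}^{T;Y}$ and $\sigma_{\max_2}^{T;Y}$ be the largest and second-largest singular values of $W^{T;Y}$ (counted with multiplicity), with corresponding unit right singular vectors $L_\sigma^{W^{T;Y}}$ and $L_{\sigma_2}^{W^{T;Y}}$, where in the case $\sigma_{\max}^{T;Y}=1$ one takes $L_\sigma^{W^{T;Y}}=\sqrt{P_S}$ and $L_{\sigma_2}^{W^{T;Y}}\perp\sqrt{P_S}$. (i) If $\sigma_{\max}^{T;Y}>1$, then $$P_2\ge\frac12\epsilon^2\left(\frac{\sigma_{\max}^{T;Y}}{K}\right)^2,$$ where $K\ge1$ is the smallest constant with $K\geq 1$ satisfying $\frac12\epsilon^2\|W^{X;Y}L_\sigma^{W^{T;Y}}\|^2\le rK^2$. (ii) If $\sigma_{\max}^{T;Y}=1$,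 then $$P_2\ge\frac12\epsilon^2\left(\frac{\sigma_{\max_2}^{T;Y}}{K}\right)^2,$$ where $K\ge1$ is the smallest constant with $K\geq 1$ satisfying $\frac12\epsilon^2\|W^{X;Y}L_{\sigma_2}^{W^{T;Y}}\|^2\le rK^2$. (iii) If $|\mathcal S|=2$, then equality holds: $P_2=\frac12\epsilon^2\left(\sigma_{\max}^{T;Y}/K\right)^2$ with $K$ as in (i) if $\sigma_{\max}^{T;Y}>1$, and $P_2=\frac12\epsilon^2\left(\sigma_{\max_2}^{T;Y}/K\right)^2$ with $K$ as in (ii) if $\sigma_{\max}^{T;Y}=1$.
   Context: Distributions are regarded as column vectors, e.g. $P_S\in\mathbb R^{|\mathcal S|}$. $P_{S|T}$ is the matrix with entries $P_{S|T}(s|t)$ in row $s$, column $t$ (so $P_S=P_{S|T}P_T$), and similarly $P_{T|X}$ (so $P_T=P_{T|X}P_X$). $A-B-C$ being a Markov chain means $A$ and $C$ are conditionally independent given $B$. $\|\cdot\|$ is the Euclidean norm. $\sqrt{P_S}$ is the vector with entries $\sqrt{P_S(s)}$; $[\sqrt{P_S}]$ is the diagonal matrix with these entries and $[\sqrt{P_S}^{-1}]$ is its inverse; similarly for $P_T,P_X$. Definitions: $$W^{T;Y}=[\sqrt{P_T}^{-1}]P_{S|T}^{-1}[\sqrt{P_S}],\qquad W^{X;Y}=[\sqrt{P_X}^{-1}]P_{T|X}^{-1}P_{S|T}^{-1}[\sqrt{P_S}].$$ The vector $\sqrt{P_S}$ is a unit right singular vector of both $W^{T;Y}$ and $W^{X;Y}$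 with singular value $1$. *)

theory Defs
  imports "HOL-Probability.Probability"
begin

definition distr_vec :: "'a measure \<Rightarrow> ('a \<Rightarrow> 's::finite) \<Rightarrow> real ^ 's" where
  "distr_vec M S = (\<chi> s. \<P>(\<omega> in M. S \<omega> = s))"

definition cond_mat ::
  "'a measure \<Rightarrow> ('a \<Rightarrow> 's::finite) \<Rightarrow> ('a \<Rightarrow> 't::finite) \<Rightarrow> real ^ 't ^ 's" where
  "cond_mat M S T = (\<chi> s t. \<P>(\<omega> in M. S \<omega> = s \<bar> T \<omega> = t))"

definition full_support :: "'a measure \<Rightarrow> ('a \<Rightarrow> 's::finite) \<Rightarrow> bool" where
  "full_support M S \<longleftrightarrow> (\<forall>s. \<P>(\<omega> in M. S \<omega> = s) > 0)"

definition markov_chain ::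
  "'a measure \<Rightarrow> ('a \<Rightarrow> 'u) \<Rightarrow> ('a \<Rightarrow> 'v) \<Rightarrow> ('a \<Rightarrow> 'w) \<Rightarrow> bool" where
  "markov_chain M A B C \<longleftrightarrow>
     (\<forall>a b c. \<P>(\<omega> in M. B \<omega> = b) > 0 \<longrightarrow>
        \<P>(\<omega> in M. A \<omega> = a \<and> C \<omega> = c \<bar> B \<omega> = b)
        = \<P>(\<omega> in M. A \<omega> = a \<bar> B \<omega> = b) * \<P>(\<omega> in M. C \<omega> = c \<bar> B \<omega> = b))"

definition sqrt_vec :: "real ^ 'n \<Rightarrow> real ^ 'n" where
  "sqrt_vec p = (\<chi> i. sqrt (p $ i))"

definition diag_mat :: "real ^ 'n \<Rightarrow> real ^ 'n ^ 'n" where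
  "diag_mat d = (\<chi> i j. if i = j then d $ i else 0)"

definition W_TY ::
  "'a measure \<Rightarrow> ('a \<Rightarrow> 's::finite) \<Rightarrow> ('a \<Rightarrow> 't::finite) \<Rightarrow> real ^ 's ^ 't" where
  "W_TY M S T =
     matrix_inv (diag_mat (sqrt_vec (distr_vec M T))) ** matrix_inv (cond_mat M S T)
     ** diag_mat (sqrt_vec (distr_vec M S))"

definition W_XY ::
  "'a measure \<Rightarrow> ('a \<Rightarrow> 's::finite) \<Rightarrow> ('a \<Rightarrow> 't::finite) \<Rightarrow> ('a \<Rightarrow> 'x::finite) \<Rightarrow> real ^ 's ^ 'x" where
  "W_XY M S T X =
     matrix_inv (diag_mat (sqrt_vec (distr_vec M X))) ** matrix_inv (cond_mat M T X)
     ** matrix_inv (cond_mat M S T) ** diag_mat (sqrt_vec (distr_vec M S))"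

definition unit_right_singular_vector :: "real ^ 'n ^ 'm \<Rightarrow> real \<Rightarrow> real ^ 'n \<Rightarrow> bool" where
  "unit_right_singular_vector A \<sigma> v \<longleftrightarrow>
     0 \<le> \<sigma> \<and> norm v = 1 \<and>
     (\<exists>u. norm u = 1 \<and> A *v v = \<sigma> *\<^sub>R u \<and> transpose A *v u = \<sigma> *\<^sub>R v)"

text \<open>The multiplicity of a singular value is the dimension of the span of its right singular
  vectors; for \<open>\<sigma> > 0\<close> this is the \<open>\<sigma>\<^sup>2\<close>-eigenspace of \<^term>\<open>transpose A ** A\<close>.\<close>

definition singular_values :: "real ^ 'n ^ 'm \<Rightarrow> real multiset" where
  "singular_values A =
     (\<Sum>\<sigma> \<in> {\<sigma>. \<exists>v. unit_right_singular_vector A \<sigma> v}.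
        replicate_mset (dim {v. unit_right_singular_vector A \<sigma> v}) \<sigma>)"

definition singular_values_desc :: "real ^ 'n ^ 'm \<Rightarrow> real list" where
  "singular_values_desc A = rev (sorted_list_of_multiset (singular_values A))"

definition sigma_max :: "real ^ 'n ^ 'm \<Rightarrow> real" where
  "sigma_max A = singular_values_desc A ! 0"

definition sigma_max2 :: "real ^ 'n ^ 'm \<Rightarrow> real" where
  "sigma_max2 A = singular_values_desc A ! 1"

text \<open>The alphabet of \<open>Y\<close> ranges over the finite sets of naturals; up to relabelling these are
  all finite alphabets. It is nonempty because the probabilities \<open>p y\<close> sum to 1. The constraints
  on \<open>L y\<close> are also imposed on letters of probability 0.\<close>

definition feasible ::
  "'a measure \<Rightarrow> ('a \<Rightarrow> 's::finite) \<Rightarrow> ('a \<Rightarrow> 't::finite) \<Rightarrow> ('a \<Rightarrow> 'x::finite)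
     \<Rightarrow> real \<Rightarrow> real \<Rightarrow> nat set \<Rightarrow> (nat \<Rightarrow> real) \<Rightarrow> (nat \<Rightarrow> real ^ 's) \<Rightarrow> bool" where
  "feasible M S T X \<epsilon> r Y p L \<longleftrightarrow>
     finite Y \<and> (\<forall>y\<in>Y. 0 \<le> p y) \<and> (\<Sum>y\<in>Y. p y) = 1 \<and>
     (\<forall>y\<in>Y. orthogonal (L y) (sqrt_vec (distr_vec M S))) \<and>
     (\<Sum>y\<in>Y. p y *\<^sub>R L y) = 0 \<and>
     (\<forall>y\<in>Y. (norm (L y))\<^sup>2 \<le> 1) \<and>
     1/2 * \<epsilon>\<^sup>2 * (\<Sum>y\<in>Y. p y * (norm (W_XY M S T X *v L y))\<^sup>2) \<le> r"

definition objective_values ::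
  "'a measure \<Rightarrow> ('a \<Rightarrow> 's::finite) \<Rightarrow> ('a \<Rightarrow> 't::finite) \<Rightarrow> ('a \<Rightarrow> 'x::finite)
     \<Rightarrow> real \<Rightarrow> real \<Rightarrow> real set" where
  "objective_values M S T X \<epsilon> r =
     {1/2 * \<epsilon>\<^sup>2 * (\<Sum>y\<in>Y. p y * (norm (W_TY M S T *v L y))\<^sup>2) | Y p L.
        feasible M S T X \<epsilon> r Y p L}"

definition P2 ::
  "'a measure \<Rightarrow> ('a \<Rightarrow> 's::finite) \<Rightarrow> ('a \<Rightarrow> 't::finite) \<Rightarrow> ('a \<Rightarrow> 'x::finite)
     \<Rightarrow> real \<Rightarrow> real \<Rightarrow> real" where
  "P2 M S T X \<epsilon> r = (GREATEST v. v \<in> objective_values M S T X \<epsilon> r)"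

definition K_const :: "real ^ 'n ^ 'm \<Rightarrow> real \<Rightarrow> real \<Rightarrow> real ^ 'n \<Rightarrow> real" where
  "K_const W \<epsilon> r L = (LEAST K. 1 \<le> K \<and> 1/2 * \<epsilon>\<^sup>2 * (norm (W *v L))\<^sup>2 \<le> r * K\<^sup>2)"

end

theory Submission
  imports Defs
begin

text \<open>
  Replacing every vector \<open>L\<^sub>y\<close> by the pair \<open>\<plusminus>L\<^sub>y\<close> with half the probability each makes the mean
  vanish without changing the second moments. Hence the attainable pairs of moments
  \<open>(\<Sum>\<^sub>y P\<^sub>y \<parallel>W\<^sup>T\<^sup>Y L\<^sub>y\<parallel>\<^sup>2, \<Sum>\<^sub>y P\<^sub>y \<parallel>W\<^sup>X\<^sup>Y L\<^sub>y\<parallel>\<^sup>2)\<close> form the convex hull, in the plane, of the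
  image of the compact set of vectors of norm at most 1 orthogonal to \<open>\<surd>P\<^sub>S\<close>. This hull is compact,
  so the maximum exists although the alphabet size is unbounded, and evaluating at \<open>v / K\<close> gives the
  lower bounds. A singular vector for a value above 1 is orthogonal to \<open>\<surd>P\<^sub>S\<close>, which is a singular
  vector with value 1. For binary alphabets the orthogonal complement of \<open>\<surd>P\<^sub>S\<close> is a line, and only
  the second moment along it remains to be optimised.
\<close>

section \<open>Moment pairs of zero-mean families as a convex hull\<close>

text \<open>Serves to sum over an alphabet in which every index \<open>i\<close> of a convex
  combination is split into the two letters \<open>2 * i\<close> and
  \<open>2 * i + 1\<close>.\<close>

lemma sum_interval_pairs:
  fixes g :: "nat \<Rightarrow> 'b::comm_monoid_add"
  shows "sum g {2..<2 * k + 2} = (\<Sum>i\<in>{1..k}. g (2 * i) + g (2 * i + 1))"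
  by (induction k) (simp_all add: add.assoc)

lemma zero_mean_moments_eq_convex_hull:
  fixes f :: "'a::real_vector \<Rightarrow> 'b::real_vector"
  assumes f: "\<And>x. f (- x) = f x" and D: "\<And>x. x \<in> D \<Longrightarrow> - x \<in> D"
  shows "{\<Sum>y\<in>Y. p y *\<^sub>R f (L y) | (Y::nat set) p L.
            finite Y \<and> (\<forall>y\<in>Y. 0 \<le> p y) \<and> sum p Y = 1 \<and> (\<forall>y\<in>Y. L y \<in> D) \<and>
            (\<Sum>y\<in>Y. p y *\<^sub>R L y) = 0}
         = convex hull (f ` D)" (is "?M = _")
proof (intro equalityI subsetI)
  fix z assume "z \<in> ?M"
  then obtain Y :: "nat set" and p L where Y: "finite Y" "\<forall>y\<in>Y. 0 \<le> p y" "sum p Y = 1"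
    "\<forall>y\<in>Y. L y \<in> D" and z: "z = (\<Sum>y\<in>Y. p y *\<^sub>R f (L y))" by blast
  have "f (L y) \<in> convex hull (f ` D)" if "y \<in> Y" for y
    using that Y(4) by (intro hull_inc) blast
  then show "z \<in> convex hull (f ` D)"
    unfolding z using Y by (intro convex_sum) auto
next
  fix z assume "z \<in> convex hull (f ` D)"
  then obtain k u x where u: "\<And>i. i \<in> {1..k::nat} \<Longrightarrow> 0 \<le> u i \<and> x i \<in> f ` D"
    "sum u {1..k} = 1" "(\<Sum>i\<in>{1..k}. u i *\<^sub>R x i) = z"
    unfolding convex_hull_indexed by blast
  then have "\<forall>i\<in>{1..k}. \<exists>d\<in>D. x i = f d" by blast
  then obtain d where d: "\<And>i. i \<in> {1..k} \<Longrightarrow> d i \<in> D \<and> x i = f (d i)" by metis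
  \<comment> \<open>The letters \<open>2 * i\<close> and \<open>2 * i + 1\<close> carry
    \<open>d i\<close> and \<open>- d i\<close>, each with half of the weight \<open>u i\<close>.
    The alphabet starts at 2 because the convex combination is indexed from 1.\<close>
  define p where "p y = u (y div 2) / 2" for y
  define L where "L y = (if even y then d (y div 2) else - d (y div 2))" for y
  have mem: "y div 2 \<in> {1..k}" if "y \<in> {2..<2 * k + 2}" for y
    using that by auto
  have "(\<Sum>y\<in>{2..<2 * k + 2}. p y *\<^sub>R f (L y)) = z"
    unfolding sum_interval_pairs u(3)[symmetric]
    by (rule sum.cong) (simp_all add: p_def L_def f d flip: scaleR_add_left)
  moreover have "sum p {2..<2 * k + 2} = 1"
    unfolding sum_interval_pairs u(2)[symmetric] by (rule sum.cong) (simp_all add: p_def)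
  moreover have "(\<Sum>y\<in>{2..<2 * k + 2}. p y *\<^sub>R L y) = 0"
    unfolding sum_interval_pairs by (rule sum.neutral) (simp add: p_def L_def)
  moreover have "0 \<le> p y" "L y \<in> D" if "y \<in> {2..<2 * k + 2}" for y
    using mem[OF that] u(1) d D by (auto simp: p_def L_def)
  ultimately show "z \<in> ?M"
    by (intro CollectI exI[of _ "{2..<2 * k + 2}"] exI[of _ p] exI[of _ L]) auto
qed

text \<open>Objective and constraint are the two coordinates of the moment of one even map into the
  plane. The zero-mean and norm conditions are thereby absorbed into a convex hull, and the bound by
  \<open>r\<close> becomes a half-plane.\<close>

lemma objective_values_eq:
  fixes S :: "'a \<Rightarrow> 's::finite"
  shows "objective_values M S T X \<epsilon> r =
    (\<lambda>z. 1/2 * \<epsilon>\<^sup>2 * fst z) `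
      (convex hull ((\<lambda>x. ((norm (W_TY M S T *v x))\<^sup>2, (norm (W_XY M S T X *v x))\<^sup>2)) `
          {x. orthogonal x (sqrt_vec (distr_vec M S)) \<and> norm x \<le> 1})
        \<inter> {z. 1/2 * \<epsilon>\<^sup>2 * snd z \<le> r})"
proof -
  define q where "q = sqrt_vec (distr_vec M S)"
  define f where "f = (\<lambda>x. ((norm (W_TY M S T *v x))\<^sup>2, (norm (W_XY M S T X *v x))\<^sup>2))"
  have neg: "A *v (- x) = - (A *v x)" for A :: "real ^ 's ^ 'n" and x
    by (simp add: vec_eq_iff matrix_vector_mult_def sum_negf)
  have "f (- x) = f x" for x
    by (simp add: f_def neg)
  then have hull: "convex hull (f ` {x. orthogonal x q \<and> norm x \<le> 1}) =
      {\<Sum>y\<in>Y. p y *\<^sub>R f (L y) | (Y::nat set) p L.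
            finite Y \<and> (\<forall>y\<in>Y. 0 \<le> p y) \<and> sum p Y = 1 \<and>
            (\<forall>y\<in>Y. L y \<in> {x. orthogonal x q \<and> norm x \<le> 1}) \<and> (\<Sum>y\<in>Y. p y *\<^sub>R L y) = 0}"
    by (intro zero_mean_moments_eq_convex_hull[symmetric]) (auto simp: orthogonal_clauses)
  have f: "fst (\<Sum>y\<in>Y. p y *\<^sub>R f (L y)) = (\<Sum>y\<in>Y. p y * (norm (W_TY M S T *v L y))\<^sup>2)"
    "snd (\<Sum>y\<in>Y. p y *\<^sub>R f (L y)) = (\<Sum>y\<in>Y. p y * (norm (W_XY M S T X *v L y))\<^sup>2)"
    for Y :: "nat set" and p L
    by (simp_all add: f_def fst_sum snd_sum)
  have sq: "(norm x)\<^sup>2 \<le> 1 \<longleftrightarrow> norm x \<le> 1" for x :: "real ^ 's"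
    by (simp add: abs_square_le_1)
  let ?C = "convex hull (f ` {x. orthogonal x q \<and> norm x \<le> 1})"
  let ?g = "\<lambda>z. 1/2 * \<epsilon>\<^sup>2 * fst z"
  have "objective_values M S T X \<epsilon> r = ?g ` (?C \<inter> {z. 1/2 * \<epsilon>\<^sup>2 * snd z \<le> r})"
  proof (intro equalityI subsetI)
    fix v assume "v \<in> objective_values M S T X \<epsilon> r"
    then obtain Y p L where F: "feasible M S T X \<epsilon> r Y p L"
      and v: "v = 1/2 * \<epsilon>\<^sup>2 * (\<Sum>y\<in>Y. p y * (norm (W_TY M S T *v L y))\<^sup>2)"
      unfolding objective_values_def by blast
    have "(\<Sum>y\<in>Y. p y *\<^sub>R f (L y)) \<in> ?C"
      unfolding hull using F unfolding feasible_def sq q_def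
      by (intro CollectI exI[of _ Y] exI[of _ p] exI[of _ L]) blast
    moreover have "1/2 * \<epsilon>\<^sup>2 * snd (\<Sum>y\<in>Y. p y *\<^sub>R f (L y)) \<le> r"
      using F unfolding f feasible_def by blast
    ultimately show "v \<in> ?g ` (?C \<inter> {z. 1/2 * \<epsilon>\<^sup>2 * snd z \<le> r})"
      unfolding v f(1)[symmetric] by blast
  next
    fix v assume "v \<in> ?g ` (?C \<inter> {z. 1/2 * \<epsilon>\<^sup>2 * snd z \<le> r})"
    then obtain z where z: "z \<in> ?C" "1/2 * \<epsilon>\<^sup>2 * snd z \<le> r" "v = ?g z" by blast
    then obtain Y :: "nat set" and p L where Y: "finite Y" "\<forall>y\<in>Y. 0 \<le> p y" "sum p Y = 1"
      "\<forall>y\<in>Y. L y \<in> {x. orthogonal x q \<and> norm x \<le> 1}" "(\<Sum>y\<in>Y. p y *\<^sub>R L y) = 0"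
      and zY: "z = (\<Sum>y\<in>Y. p y *\<^sub>R f (L y))" unfolding hull by blast
    have "feasible M S T X \<epsilon> r Y p L"
      using Y z(2) unfolding feasible_def zY f sq q_def by blast
    then show "v \<in> objective_values M S T X \<epsilon> r"
      unfolding objective_values_def z(3) zY f by blast
  qed
  then show ?thesis
    unfolding q_def f_def .
qed

section \<open>Existence of the maximum\<close>

lemma P2_greatest:
  assumes "r \<ge> 0"
  shows "P2 M S T X \<epsilon> r \<in> objective_values M S T X \<epsilon> r"
    and "v \<in> objective_values M S T X \<epsilon> r \<Longrightarrow> v \<le> P2 M S T X \<epsilon> r"
proof -
  define q where "q = sqrt_vec (distr_vec M S)"
  define f where "f = (\<lambda>x. ((norm (W_TY M S T *v x))\<^sup>2, (norm (W_XY M S T X *v x))\<^sup>2))"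
  define D where "D = {x. orthogonal x q \<and> norm x \<le> 1}"
  define C where "C = convex hull (f ` D) \<inter> {z. 1/2 * \<epsilon>\<^sup>2 * snd z \<le> r}"
  have eq: "objective_values M S T X \<epsilon> r = (\<lambda>z. 1/2 * \<epsilon>\<^sup>2 * fst z) ` C"
    unfolding C_def D_def f_def q_def by (rule objective_values_eq)
  have "D = {x. x \<bullet> q = 0} \<inter> cball 0 1"
    by (auto simp: D_def orthogonal_def)
  moreover have "closed {x. x \<bullet> q = 0}"
    by (intro closed_Collect_eq continuous_intros)
  ultimately have "compact D"
    by (simp add: closed_Int_compact)
  moreover have "continuous_on D f"
    unfolding f_def by (intro continuous_intros matrix_vector_mult_linear_continuous_on)
  ultimately have "compact (convex hull (f ` D))"
    by (intro compact_convex_hull compact_continuous_image)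
  moreover have "closed {z::real \<times> real. 1/2 * \<epsilon>\<^sup>2 * snd z \<le> r}"
    by (intro closed_Collect_le continuous_intros)
  ultimately have "compact C"
    unfolding C_def by (rule compact_Int_closed)
  then have cpt: "compact (objective_values M S T X \<epsilon> r)"
    unfolding eq by (intro compact_continuous_image continuous_intros)
  \<comment> \<open>The zero vector has both moments zero, so it meets the constraint as soon as
    \<open>r\<close> is nonnegative. This gives the nonemptiness needed for a supremum to be
    attained.\<close>
  have "0 \<in> D" by (simp add: D_def orthogonal_def)
  then have "f 0 \<in> convex hull (f ` D)" by (intro hull_inc imageI)
  then have "f 0 \<in> C"
    using assms by (simp add: C_def f_def)
  then have "objective_values M S T X \<epsilon> r \<noteq> {}"
    unfolding eq by blast
  from compact_attains_sup[OF cpt this] obtain m where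
    m: "m \<in> objective_values M S T X \<epsilon> r" "\<forall>v\<in>objective_values M S T X \<epsilon> r. v \<le> m" by blast
  have "P2 M S T X \<epsilon> r = m"
    unfolding P2_def using m by (intro Greatest_equality) auto
  with m show "P2 M S T X \<epsilon> r \<in> objective_values M S T X \<epsilon> r"
    "v \<in> objective_values M S T X \<epsilon> r \<Longrightarrow> v \<le> P2 M S T X \<epsilon> r" by auto
qed

section \<open>The scaling constant\<close>

text \<open>Dividing the constraint by \<open>r\<close> leaves a lower bound on the square of
  \<open>K\<close>. For \<open>K\<close> at least 1 this is a lower bound on \<open>K\<close>
  itself, so the admissible constants form a closed half-line and \<open>LEAST\<close> picks its
  endpoint.\<close>

lemma K_const_eq:
  assumes "r > 0"
  shows "K_const W \<epsilon> r L = max 1 (sqrt (1/2 * \<epsilon>\<^sup>2 * (norm (W *v L))\<^sup>2 / r))"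
proof -
  define a where "a = 1/2 * \<epsilon>\<^sup>2 * (norm (W *v L))\<^sup>2 / r"
  have iff: "1/2 * \<epsilon>\<^sup>2 * (norm (W *v L))\<^sup>2 \<le> r * K\<^sup>2 \<longleftrightarrow> sqrt a \<le> K" if "1 \<le> K" for K
  proof -
    have "1/2 * \<epsilon>\<^sup>2 * (norm (W *v L))\<^sup>2 \<le> r * K\<^sup>2 \<longleftrightarrow> a \<le> K\<^sup>2"
      unfolding a_def using assms by (simp add: pos_divide_le_eq algebra_simps)
    also have "\<dots> \<longleftrightarrow> sqrt a \<le> K"
      using that by (metis real_sqrt_le_iff real_sqrt_unique order_trans zero_le_one)
    finally show ?thesis .
  qed
  show ?thesis
    unfolding K_const_def a_def[symmetric]
  proof (rule Least_equality)
    show "1 \<le> max 1 (sqrt a) \<and> 1/2 * \<epsilon>\<^sup>2 * (norm (W *v L))\<^sup>2 \<le> r * (max 1 (sqrt a))\<^sup>2"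
      by (subst iff) auto
    show "max 1 (sqrt a) \<le> K"
      if "1 \<le> K \<and> 1/2 * \<epsilon>\<^sup>2 * (norm (W *v L))\<^sup>2 \<le> r * K\<^sup>2" for K
      using that iff[of K] by simp
  qed
qed

text \<open>The second claim makes \<open>v / K\<close> feasible for the lower bound on
  \<open>P2\<close>. The third says that minimality of \<open>K\<close> makes one of its two
  conditions tight, which is what the upper bound uses.\<close>

lemma K_const_props:
  assumes "r > 0"
  shows "K_const W \<epsilon> r L \<ge> 1"
    and "1/2 * \<epsilon>\<^sup>2 * (norm (W *v L))\<^sup>2 \<le> r * (K_const W \<epsilon> r L)\<^sup>2"
    and "K_const W \<epsilon> r L = 1 \<or> 1/2 * \<epsilon>\<^sup>2 * (norm (W *v L))\<^sup>2 = r * (K_const W \<epsilon> r L)\<^sup>2"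
proof -
  define a where "a = 1/2 * \<epsilon>\<^sup>2 * (norm (W *v L))\<^sup>2 / r"
  have a: "a \<ge> 0" "1/2 * \<epsilon>\<^sup>2 * (norm (W *v L))\<^sup>2 = r * a"
    using assms by (simp_all add: a_def)
  have K: "K_const W \<epsilon> r L = max 1 (sqrt a)"
    unfolding a_def by (rule K_const_eq[OF assms])
  show "K_const W \<epsilon> r L \<ge> 1" by (simp add: K)
  show "K_const W \<epsilon> r L = 1 \<or> 1/2 * \<epsilon>\<^sup>2 * (norm (W *v L))\<^sup>2 = r * (K_const W \<epsilon> r L)\<^sup>2"
    unfolding a K using a by (auto simp: max_def)
  have "a \<le> (max 1 (sqrt a))\<^sup>2"
    using a by (auto simp: max_def)
  then show "1/2 * \<epsilon>\<^sup>2 * (norm (W *v L))\<^sup>2 \<le> r * (K_const W \<epsilon> r L)\<^sup>2"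
    unfolding a K using assms by simp
qed

section \<open>Bounds along a single direction\<close>

text \<open>The vector \<open>v / K\<close> lies in the unit ball because \<open>K\<close> is at
  least 1, and it meets the moment constraint by the choice of \<open>K\<close>. Its image is a
  point of the convex hull, hence its objective is attained.\<close>

lemma P2_ge_direction:
  assumes "r > 0" and "norm v = 1" and "orthogonal v (sqrt_vec (distr_vec M S))"
  shows "P2 M S T X \<epsilon> r
           \<ge> 1/2 * \<epsilon>\<^sup>2 * (norm (W_TY M S T *v v) / K_const (W_XY M S T X) \<epsilon> r v)\<^sup>2"
proof -
  define K where "K = K_const (W_XY M S T X) \<epsilon> r v"
  define f where "f = (\<lambda>x. ((norm (W_TY M S T *v x))\<^sup>2, (norm (W_XY M S T X *v x))\<^sup>2))"
  note K = K_const_props[OF \<open>r > 0\<close>, where W = "W_XY M S T X" and \<epsilon> = \<epsilon> and L = v, folded K_def]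
  let ?x = "inverse K *\<^sub>R v"
  have fx: "f ?x = ((norm (W_TY M S T *v v) / K)\<^sup>2, (norm (W_XY M S T X *v v) / K)\<^sup>2)"
    using K(1) by (simp add: f_def matrix_vector_mult_scaleR power_divide power_mult_distrib
        divide_inverse power_inverse mult.commute)
  have "?x \<in> {x. orthogonal x (sqrt_vec (distr_vec M S)) \<and> norm x \<le> 1}"
    using assms K(1) by (simp add: orthogonal_clauses inverse_le_1_iff)
  then have "f ?x \<in> convex hull (f ` {x. orthogonal x (sqrt_vec (distr_vec M S)) \<and> norm x \<le> 1})"
    by (intro hull_inc imageI)
  moreover have "1/2 * \<epsilon>\<^sup>2 * (norm (W_XY M S T X *v v) / K)\<^sup>2 \<le> r"
    using K(1,2) by (simp add: power_divide field_simps)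
  ultimately have "1/2 * \<epsilon>\<^sup>2 * fst (f ?x) \<in> objective_values M S T X \<epsilon> r"
    unfolding objective_values_eq f_def[symmetric] using fx by (intro imageI) simp
  then show ?thesis
    unfolding K_def[symmetric] fx fst_conv by (rule P2_greatest(2)[OF less_imp_le[OF assms(1)]])
qed

text \<open>If all \<open>L y\<close> are multiples \<open>t y\<close> of \<open>v\<close>, every
  second moment is the same scalar \<open>m\<close> times its value at \<open>v\<close>, so the task
  is to bound \<open>m\<close> by the inverse square of \<open>K\<close>.\<close>

lemma P2_le_one_dim:
  fixes S :: "'a \<Rightarrow> 's::finite"
  assumes "r > 0" and v: "norm v = 1"
    and line: "\<And>x. orthogonal x (sqrt_vec (distr_vec M S)) \<Longrightarrow> x \<in> span {v}"
  shows "P2 M S T X \<epsilon> r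
           \<le> 1/2 * \<epsilon>\<^sup>2 * (norm (W_TY M S T *v v) / K_const (W_XY M S T X) \<epsilon> r v)\<^sup>2"
proof -
  define K where "K = K_const (W_XY M S T X) \<epsilon> r v"
  note K = K_const_props[OF \<open>r > 0\<close>, where W = "W_XY M S T X" and \<epsilon> = \<epsilon> and L = v, folded K_def]
  have "P2 M S T X \<epsilon> r \<in> objective_values M S T X \<epsilon> r"
    using P2_greatest(1) assms(1) by (metis less_imp_le)
  then obtain Y p L where F: "feasible M S T X \<epsilon> r Y p L"
    and P: "P2 M S T X \<epsilon> r = 1/2 * \<epsilon>\<^sup>2 * (\<Sum>y\<in>Y. p y * (norm (W_TY M S T *v L y))\<^sup>2)"
    unfolding objective_values_def by blast
  have "\<forall>y\<in>Y. \<exists>t. L y = t *\<^sub>R v"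
    using F line unfolding feasible_def span_singleton by blast
  then obtain t where t: "\<And>y. y \<in> Y \<Longrightarrow> L y = t y *\<^sub>R v" by metis
  define m where "m = (\<Sum>y\<in>Y. p y * (t y)\<^sup>2)"
  have moment: "(\<Sum>y\<in>Y. p y * (norm (A *v L y))\<^sup>2) = m * (norm (A *v v))\<^sup>2"
    for A :: "real ^ 's ^ 'n"
    unfolding m_def sum_distrib_right
    by (rule sum.cong) (simp_all add: t matrix_vector_mult_scaleR power_mult_distrib)
  have "m \<le> (\<Sum>y\<in>Y. p y * 1)"
    unfolding m_def
  proof (intro sum_mono mult_left_mono)
    fix y assume y: "y \<in> Y"
    then have "(norm (L y))\<^sup>2 \<le> 1" "0 \<le> p y" using F unfolding feasible_def by blast+
    then show "(t y)\<^sup>2 \<le> 1" "0 \<le> p y" by (simp_all add: t[OF y] v)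
  qed
  then have m1: "m \<le> 1" using F by (simp add: feasible_def)
  have mr: "m * (1/2 * \<epsilon>\<^sup>2 * (norm (W_XY M S T X *v v))\<^sup>2) \<le> r"
    using F by (simp add: feasible_def moment mult_ac)
  \<comment> \<open>Two upper bounds on \<open>m\<close> are available: 1 from the norm constraint,
    and one from the moment constraint. The first settles \<open>K = 1\<close>; otherwise the
    constraint defining \<open>K\<close> is tight and the second applies.\<close>
  have "m * K\<^sup>2 \<le> 1"
  proof (cases "K = 1")
    case True then show ?thesis using m1 by simp
  next
    case False
    with K(3) mr have "r * (m * K\<^sup>2) \<le> r * 1" by (simp add: mult_ac)
    then show ?thesis using assms(1) by (simp only: mult_le_cancel_left_pos)
  qed
  then have "m \<le> 1 / K\<^sup>2" using K(1) by (simp add: pos_le_divide_eq)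
  then have "m * (norm (W_TY M S T *v v))\<^sup>2 \<le> 1 / K\<^sup>2 * (norm (W_TY M S T *v v))\<^sup>2"
    by (rule mult_right_mono) simp
  then have "m * (norm (W_TY M S T *v v))\<^sup>2 \<le> (norm (W_TY M S T *v v) / K)\<^sup>2"
    by (simp add: power_divide)
  then show ?thesis unfolding P moment K_def[symmetric]
    by (intro mult_left_mono) auto
qed

section \<open>Orthogonality of singular vectors\<close>

text \<open>A hyperplane in the plane has dimension 1, so the single nonzero vector \<open>v\<close>
  in it already spans it.\<close>

lemma orthogonal_complement_span:
  fixes q v x :: "real ^ 'n"
  assumes "CARD('n) = 2" "q \<noteq> 0" "v \<noteq> 0" "orthogonal v q" "orthogonal x q"
  shows "x \<in> span {v}"
proof -
  have "dim {x. q \<bullet> x = 0} = 1"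
    using assms by (simp add: dim_hyperplane)
  then have "{x. q \<bullet> x = 0} \<subseteq> span {v}"
    using assms by (intro card_ge_dim_independent) (auto simp: orthogonal_def inner_commute)
  then show ?thesis
    using assms by (auto simp: orthogonal_def inner_commute)
qed

lemma norm_right_singular_vector:
  assumes "unit_right_singular_vector A \<sigma> v"
  shows "norm v = 1" "norm (A *v v) = \<sigma>"
  using assms by (auto simp: unit_right_singular_vector_def)

text \<open>Both \<open>v\<close> and \<open>q\<close> are eigenvectors of
  \<open>transpose A ** A\<close>, for the distinct eigenvalues \<open>\<sigma> * \<sigma>\<close>
  and 1. Moving \<open>A\<close> across the inner product twice gives the two equations that are
  compared.\<close>

lemma singular_vectors_orthogonal:
  assumes "unit_right_singular_vector A \<sigma> v" and "\<sigma> > 1"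
    and "A *v q = q'" and "q' v* A = q"
  shows "orthogonal v q"
proof -
  obtain u where u: "A *v v = \<sigma> *\<^sub>R u" "u v* A = \<sigma> *\<^sub>R v"
    using assms(1) unfolding unit_right_singular_vector_def transpose_matrix_vector by blast
  note adj = dot_lmul_matrix[of _ A]
  have "\<sigma> * (v \<bullet> q) = u \<bullet> q'"
    using adj[of u q] u assms by simp
  moreover have "q \<bullet> v = \<sigma> * (q' \<bullet> u)"
    using adj[of q' v] u assms by simp
  ultimately have "\<sigma> * \<sigma> * (v \<bullet> q) = v \<bullet> q"
    by (simp add: inner_commute)
  moreover have "\<sigma> * \<sigma> \<noteq> 1"
    using assms(2) by (metis less_1_mult less_irrefl)
  ultimately show ?thesis
    by (auto simp: orthogonal_def)
qed

section \<open>Inverses and diagonal matrices\<close>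

lemma matrix_inv_works:
  assumes "invertible A"
  shows "A ** matrix_inv A = mat 1" "matrix_inv A ** A = mat 1"
  using someI_ex[OF assms[unfolded invertible_def]] by (simp_all add: matrix_inv_def)

lemma diag_mat_mult_vec: "diag_mat d *v x = (\<chi> i. d $ i * x $ i)"
  by (simp add: diag_mat_def matrix_vector_mult_def vec_eq_iff if_distrib[of "\<lambda>a. a * b" for b]
      cong: if_cong)

lemma invertible_diag_mat:
  fixes d :: "real ^ 'n"
  assumes "\<And>i. d $ i \<noteq> 0"
  shows "invertible (diag_mat d)"
  unfolding invertible_def
proof (intro exI conjI)
  show "diag_mat d ** diag_mat (\<chi> i. inverse (d $ i)) = mat 1"
    "diag_mat (\<chi> i. inverse (d $ i)) ** diag_mat d = mat 1"
    by (simp_all add: matrix_eq diag_mat_mult_vec assms flip: matrix_vector_mul_assoc mult.assoc)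
qed

lemma vec_mult_diag_mat: "x v* diag_mat d = (\<chi> i. x $ i * d $ i)"
  by (simp add: diag_mat_def vector_matrix_mult_def vec_eq_iff if_distrib[of "\<lambda>a. b * a" for b]
      cong: if_cong)

section \<open>Conditional probability matrices and the singular value 1\<close>

context prob_space
begin

text \<open>This is the law of total probability. Full support keeps the denominators of the
  conditional probabilities nonzero, so they cancel.\<close>

lemma cond_mat_mult_distr_vec:
  fixes S :: "'a \<Rightarrow> 's::finite" and T :: "'a \<Rightarrow> 't::finite"
  assumes [measurable]: "S \<in> measurable M (count_space UNIV)" "T \<in> measurable M (count_space UNIV)"
    and "full_support M T"
  shows "cond_mat M S T *v distr_vec M T = distr_vec M S"
proof -
  have "(\<Sum>t\<in>UNIV. \<P>(\<omega> in M. S \<omega> = s \<bar> T \<omega> = t) * \<P>(\<omega> in M. T \<omega> = t)) = \<P>(\<omega> in M. S \<omega> = s)"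
    for s
  proof -
    have "\<P>(\<omega> in M. T \<omega> = t) \<noteq> 0" for t
      using assms(3) by (simp add: full_support_def less_imp_neq[symmetric])
    then have "(\<Sum>t\<in>UNIV. \<P>(\<omega> in M. S \<omega> = s \<bar> T \<omega> = t) * \<P>(\<omega> in M. T \<omega> = t))
        = (\<Sum>t\<in>UNIV. \<P>(\<omega> in M. S \<omega> = s \<and> T \<omega> = t))"
      by (simp add: cond_prob_def)
    also have "\<dots> = \<P>(\<omega> in M. \<exists>t\<in>UNIV. S \<omega> = s \<and> T \<omega> = t)"
      by (intro prob_sum[symmetric]) auto
    finally show ?thesis by simp
  qed
  then show ?thesis
    by (simp add: cond_mat_def distr_vec_def matrix_vector_mult_def vec_eq_iff)
qed

lemma ones_mult_cond_mat:
  fixes S :: "'a \<Rightarrow> 's::finite" and T :: "'a \<Rightarrow> 't::finite"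
  assumes [measurable]: "S \<in> measurable M (count_space UNIV)" "T \<in> measurable M (count_space UNIV)"
    and "full_support M T"
  shows "(\<chi> s. 1) v* cond_mat M S T = (\<chi> t. 1)"
proof -
  have "(\<Sum>s\<in>UNIV. \<P>(\<omega> in M. S \<omega> = s \<bar> T \<omega> = t)) = 1" for t
  proof -
    have "(\<Sum>s\<in>UNIV. \<P>(\<omega> in M. S \<omega> = s \<and> T \<omega> = t)) = \<P>(\<omega> in M. \<exists>s\<in>UNIV. S \<omega> = s \<and> T \<omega> = t)"
      by (intro prob_sum[symmetric]) auto
    moreover have "\<P>(\<omega> in M. T \<omega> = t) \<noteq> 0"
      using assms(3) by (simp add: full_support_def less_imp_neq[symmetric])
    ultimately show ?thesis
      by (simp add: cond_prob_def flip: sum_divide_distrib)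
  qed
  then show ?thesis
    by (simp add: cond_mat_def vector_matrix_mult_def vec_eq_iff)
qed

text \<open>The right identity is total probability read backwards through the inverse matrix. The
  left one comes from the columns of \<open>cond_mat M S T\<close> summing to 1, with the all-ones
  vector linking the two diagonal factors.\<close>

lemma W_TY_sqrt_vec:
  fixes S :: "'a \<Rightarrow> 's::finite" and T :: "'a \<Rightarrow> 't::finite"
  assumes meas: "S \<in> measurable M (count_space UNIV)" "T \<in> measurable M (count_space UNIV)"
    and full: "full_support M T" and inv: "invertible (cond_mat M S T)"
  shows "W_TY M S T *v sqrt_vec (distr_vec M S) = sqrt_vec (distr_vec M T)"
    and "sqrt_vec (distr_vec M T) v* W_TY M S T = sqrt_vec (distr_vec M S)"
proof -
  define P where "P = cond_mat M S T"
  define D where "D = diag_mat (sqrt_vec (distr_vec M T))"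
  define E where "E = diag_mat (sqrt_vec (distr_vec M S))"
  have W: "W_TY M S T = matrix_inv D ** matrix_inv P ** E"
    by (simp add: W_TY_def D_def E_def P_def)
  have "invertible D"
    unfolding D_def using full
    by (intro invertible_diag_mat) (simp add: sqrt_vec_def distr_vec_def full_support_def less_imp_neq[symmetric])
  note Dinv = matrix_inv_works[OF this]
  note Pinv = matrix_inv_works[OF inv, folded P_def]
  have sq: "diag_mat (sqrt_vec p) *v sqrt_vec p = p" if "\<And>i. p $ i \<ge> 0" for p :: "real ^ 'n"
    using that by (simp add: diag_mat_mult_vec sqrt_vec_def vec_eq_iff)
  have D: "D *v sqrt_vec (distr_vec M T) = distr_vec M T"
    and E: "E *v sqrt_vec (distr_vec M S) = distr_vec M S"
    unfolding D_def E_def by (rule sq; simp add: distr_vec_def)+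
  have "matrix_inv P *v distr_vec M S = distr_vec M T"
    unfolding cond_mat_mult_distr_vec[OF meas full, folded P_def, symmetric]
    by (simp add: matrix_vector_mul_assoc Pinv)
  moreover have "matrix_inv D *v distr_vec M T = sqrt_vec (distr_vec M T)"
    by (subst D[symmetric]) (simp add: matrix_vector_mul_assoc Dinv)
  ultimately show "W_TY M S T *v sqrt_vec (distr_vec M S) = sqrt_vec (distr_vec M T)"
    by (simp add: W E flip: matrix_vector_mul_assoc)
  have tD: "(\<chi> t. 1) v* D = sqrt_vec (distr_vec M T)"
    and tE: "(\<chi> s. 1) v* E = sqrt_vec (distr_vec M S)"
    by (simp_all add: D_def E_def vec_mult_diag_mat)
  have "sqrt_vec (distr_vec M T) v* matrix_inv D = (\<chi> t. 1)"
    unfolding tD[symmetric]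
    by (simp add: vector_matrix_mul_assoc Dinv)
  moreover have "(\<chi> t. 1) v* matrix_inv P = (\<chi> s. 1)"
    unfolding ones_mult_cond_mat[OF meas full, folded P_def, symmetric]
    by (simp add: vector_matrix_mul_assoc Pinv)
  ultimately show "sqrt_vec (distr_vec M T) v* W_TY M S T = sqrt_vec (distr_vec M S)"
    by (simp add: W tE flip: vector_matrix_mul_assoc)
qed

end

theorem theorem2:
  fixes M :: "'a measure"
    and S :: "'a \<Rightarrow> 's::finite" and T :: "'a \<Rightarrow> 't::finite" and X :: "'a \<Rightarrow> 'x::finite"
    and \<epsilon> r :: real and L\<sigma> L\<sigma>2 :: "real ^ 's"
  assumes "prob_space M"
    and "S \<in> measurable M (count_space UNIV)"
    and "T \<in> measurable M (count_space UNIV)"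
    and "X \<in> measurable M (count_space UNIV)"
    and "CARD('s) \<ge> 2"
    and "full_support M S" and "full_support M T" and "full_support M X"
    and "markov_chain M S T X"
    and "invertible (cond_mat M T X)" and "invertible (cond_mat M S T)"
    and "\<epsilon> > 0" and "r > 0"
    and "unit_right_singular_vector (W_TY M S T) (sigma_max (W_TY M S T)) L\<sigma>"
    and "unit_right_singular_vector (W_TY M S T) (sigma_max2 (W_TY M S T)) L\<sigma>2"
    and "sigma_max (W_TY M S T) = 1 \<Longrightarrow>
           L\<sigma> = sqrt_vec (distr_vec M S) \<and> orthogonal L\<sigma>2 (sqrt_vec (distr_vec M S))"
  shows "(P2 M S T X \<epsilon> r \<in> objective_values M S T X \<epsilon> r \<and>
          (\<forall>v \<in> objective_values M S T X \<epsilon> r. v \<le> P2 M S T X \<epsilon> r)) \<and>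
         (sigma_max (W_TY M S T) > 1 \<longrightarrow>
            P2 M S T X \<epsilon> r
              \<ge> 1/2 * \<epsilon>\<^sup>2 * (sigma_max (W_TY M S T) / K_const (W_XY M S T X) \<epsilon> r L\<sigma>)\<^sup>2) \<and>
         (sigma_max (W_TY M S T) = 1 \<longrightarrow>
            P2 M S T X \<epsilon> r
              \<ge> 1/2 * \<epsilon>\<^sup>2 * (sigma_max2 (W_TY M S T) / K_const (W_XY M S T X) \<epsilon> r L\<sigma>2)\<^sup>2) \<and>
         (CARD('s) = 2 \<longrightarrow>
            (sigma_max (W_TY M S T) > 1 \<longrightarrow>
               P2 M S T X \<epsilon> r
                 = 1/2 * \<epsilon>\<^sup>2 * (sigma_max (W_TY M S T) / K_const (W_XY M S T X) \<epsilon> r L\<sigma>)\<^sup>2) \<and>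
            (sigma_max (W_TY M S T) = 1 \<longrightarrow>
               P2 M S T X \<epsilon> r
                 = 1/2 * \<epsilon>\<^sup>2 * (sigma_max2 (W_TY M S T) / K_const (W_XY M S T X) \<epsilon> r L\<sigma>2)\<^sup>2))"
proof -
  interpret prob_space M by fact
  let ?q = "sqrt_vec (distr_vec M S)"
  note W = W_TY_sqrt_vec[OF assms(2,3,7,11)]
  note L = norm_right_singular_vector[OF assms(14)] norm_right_singular_vector[OF assms(15)]
  \<comment> \<open>A nonzero normal vector is what makes its orthogonal complement a line in the
    binary case.\<close>
  have q: "?q \<noteq> 0"
    using assms(6) by (auto simp: sqrt_vec_def distr_vec_def full_support_def vec_eq_iff less_imp_neq[symmetric])
  have orth: "orthogonal L\<sigma> ?q" if "sigma_max (W_TY M S T) > 1"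
    using singular_vectors_orthogonal[OF assms(14) that W] .
  have orth2: "orthogonal L\<sigma>2 ?q" if "sigma_max (W_TY M S T) = 1"
    using assms(16)[OF that] by blast
  have greatest: "P2 M S T X \<epsilon> r \<in> objective_values M S T X \<epsilon> r \<and>
      (\<forall>v \<in> objective_values M S T X \<epsilon> r. v \<le> P2 M S T X \<epsilon> r)"
    using P2_greatest assms(13) by (metis less_imp_le)
  note ge = P2_ge_direction[OF assms(13), where M = M and S = S and T = T and X = X and \<epsilon> = \<epsilon>]
  have le: "P2 M S T X \<epsilon> r
      \<le> 1/2 * \<epsilon>\<^sup>2 * (norm (W_TY M S T *v v) / K_const (W_XY M S T X) \<epsilon> r v)\<^sup>2"
    if "CARD('s) = 2" "norm v = 1" "orthogonal v ?q" for v
    using that q by (intro P2_le_one_dim assms(13) orthogonal_complement_span[of ?q]) auto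
  \<comment> \<open>Unfolding \<open>L\<close> turns the norms of the images of the singular vectors
    into the singular values. In the binary case the upper and lower bounds refer to the same
    direction and coincide.\<close>
  note ge1 = ge[OF L(1) orth, unfolded L] and ge2 = ge[OF L(3) orth2, unfolded L]
  note le1 = le[OF _ L(1) orth, unfolded L] and le2 = le[OF _ L(3) orth2, unfolded L]
  show ?thesis
    using greatest
    by (intro conjI impI order_antisym[OF le1 ge1] order_antisym[OF le2 ge2] ge1 ge2)
      blast+
qed

end
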